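(* Let $\mathcal{D}\subseteq\mathbb{R}^d$ be a nonempty convex compact set of diameter $D$, and let $\phi=f-g$ on $\mathcal{D}$, where $f$ and $g$ are convex, $f$ is $L_f$-smooth on $\mathcal{D}$, and $g$ is possibly nonsmooth. For every $\epsilon>0$, the DC-FW algorithm run with target accuracy $\epsilon$ from any initial point $x_0\in\mathcal{D}$ (with any of the three step-size rules (i), (ii), (iii) in the context) generates a sequence $\{x_t\}$ that satisfies $$\min_{0\le\tau\le t}\ \mathrm{gap}_{\mathrm{DC}}(x_\tau)\le\epsilon$$ within $t=\mathcal{O}(1/\epsilon)$ (outer) iterations, requiring in total at most $\mathcal{O}(1/\epsilon^2)$ calls to the linear minimization oracle. Here the constants hidden in $\mathcal{O}(\cdot)$ do not depend on $\epsilon$ (they may depend on $L_f$, $D$ and $\phi(x_0)-\min_{x\in\mathcal{D}}\phi(x)$).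
   Context: Conventions: $\|\cdot\|$ is the Euclidean norm. $f$ is differentiable and convex on $\mathcal{D}$, and $L_f$-smooth on $\mathcal{D}$ means that $\nabla f$ is $L_f$-Lipschitz on $\mathcal{D}$. The function $g$ is real-valued and convex on an open convex set containing $\mathcal{D}$, and $\partial g(x)$ is its (nonempty, convex, compact) subdifferential at $x\in\mathcal{D}$. Gap: for $y\in\mathcal{D}$, $$\mathrm{gap}_{\mathrm{DC}}(y):=\max_{x\in\mathcal{D}}\ \min_{u\in\partial g(y)}\big\{f(y)-f(x)-\langle u,y-x\rangle\big\}.$$ DC-FW algorithm (target accuracy $\epsilon>0$, initial point $x_0\in\mathcal{D}$). For $t=0,1,2,\dots$: pick a subgradient $u_t\in\partial g(x_t)$ (equal to $\nabla g(x_t)$ if $g$ is differentiable) and set $X_{t,1}=x_t$. Then for $k=1,2,\dots$: compute $S_{t,k}\in\arg\min_{x\in\mathcal{D}}\langle\nabla f(X_{t,k})-u_t,x\rangle$ (one call to the linear minimization oracle) and $D_{t,k}=S_{t,k}-X_{t,k}$; if $-\langle\nabla f(X_{t,k})-u_t,D_{t,k}\rangle\le\epsilon/2$, set $x_{t+1}=X_{t,k}$ and leave the inner loop; otherwise set $X_{t,k+1}=X_{t,k}+\eta_{t,k}D_{t,k}$. Step-size rules, with $\hat\phi_t(x)=f(x)-g(x_t)-\langle u_t,x-x_t\rangle$: (i) $\eta_{t,k}=2/(k+1)$; (ii) exact line search $\eta_{t,k}\in\arg\min_{\eta\in[0,1]}\hat\phi_t(X_{t,k}+\eta D_{t,k})$;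 (iii) Demyanov–Rubinov $\eta_{t,k}=\min\Big\{\frac{-\langle\nabla\hat\phi_t(X_{t,k}),D_{t,k}\rangle}{L_f\|D_{t,k}\|^2},1\Big\}$. *)

theory Defs
  imports "HOL-Analysis.Analysis"
begin

(* The set U is the open convex set on which g is convex.  For x in U the set below
   does not depend on the choice of U, because g is convex. *)
definition subdifferential ::
  "'a::real_inner set \<Rightarrow> ('a \<Rightarrow> real) \<Rightarrow> 'a \<Rightarrow> 'a set" where
  "subdifferential U g x = {u. \<forall>y\<in>U. g y \<ge> g x + u \<bullet> (y - x)}"

(* SUP and INF are attained (hence a max and a min) when D is nonempty and compact, U is
   an open superset of D, g is convex on U, f is continuous on D and y is in D: the
   subdifferential is then nonempty and compact, and the inner infimum is continuous in x. *)
definition gap_DC ::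
  "'a::real_inner set \<Rightarrow> 'a set \<Rightarrow> ('a \<Rightarrow> real) \<Rightarrow> ('a \<Rightarrow> real) \<Rightarrow> 'a \<Rightarrow> real" where
  "gap_DC D U f g y =
     (SUP x\<in>D. INF u\<in>subdifferential U g y. f y - f x - u \<bullet> (y - x))"

definition phi_hat ::
  "('a::real_inner \<Rightarrow> real) \<Rightarrow> ('a \<Rightarrow> real) \<Rightarrow> 'a \<Rightarrow> 'a \<Rightarrow> 'a \<Rightarrow> real" where
  "phi_hat f g xt ut x = f x - g xt - ut \<bullet> (x - xt)"

datatype step_rule = Open_Loop | Line_Search | Demyanov_Rubinov

(* h is the function minimised by the inner loop, v its gradient at the current point X,
   d the Frank-Wolfe direction.  The third rule is min (- (v . d) / (L |d|^2)) 1 with the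
   convention that the quotient is +infinity when its denominator is 0 (it arises with a
   positive numerator, e.g. for L = 0); HOL's x / 0 = 0 would give the step 0 instead. *)
fun step_size ::
  "step_rule \<Rightarrow> real \<Rightarrow> ('a::real_inner \<Rightarrow> real) \<Rightarrow> 'a \<Rightarrow> 'a \<Rightarrow> 'a \<Rightarrow> nat \<Rightarrow> real \<Rightarrow> bool"
where
  "step_size Open_Loop L h v X d k \<eta> \<longleftrightarrow> \<eta> = 2 / (real k + 1)"
| "step_size Line_Search L h v X d k \<eta> \<longleftrightarrow>
     is_arg_min (\<lambda>s. h (X + s *\<^sub>R d)) (\<lambda>s. s \<in> {0..1}) \<eta>"
| "step_size Demyanov_Rubinov L h v X d k \<eta> \<longleftrightarrow>
     \<eta> = (if L * (norm d)\<^sup>2 = 0 then 1 else min (- (v \<bullet> d) / (L * (norm d)\<^sup>2)) 1)"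

(* One inner loop, with iterates X 1, X 2, ... and oracle answers S 1, S 2, ... *)
definition inner_stop ::
  "real \<Rightarrow> ('a::real_inner \<Rightarrow> 'a) \<Rightarrow> 'a \<Rightarrow> (nat \<Rightarrow> 'a) \<Rightarrow> (nat \<Rightarrow> 'a) \<Rightarrow> nat \<Rightarrow> bool" where
  "inner_stop \<epsilon> gradf ut X S k \<longleftrightarrow>
     k \<ge> 1 \<and> - ((gradf (X k) - ut) \<bullet> (S k - X k)) \<le> \<epsilon> / 2"

definition inner_terminates ::
  "real \<Rightarrow> ('a::real_inner \<Rightarrow> 'a) \<Rightarrow> 'a \<Rightarrow> (nat \<Rightarrow> 'a) \<Rightarrow> (nat \<Rightarrow> 'a) \<Rightarrow> bool" where
  "inner_terminates \<epsilon> gradf ut X S \<longleftrightarrow> (\<exists>k. inner_stop \<epsilon> gradf ut X S k)"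

(* There is one oracle call for every k = 1, ..., n, where n is the index at which the loop
   is left.  Only meaningful if the loop terminates. *)
definition lmo_calls ::
  "real \<Rightarrow> ('a::real_inner \<Rightarrow> 'a) \<Rightarrow> 'a \<Rightarrow> (nat \<Rightarrow> 'a) \<Rightarrow> (nat \<Rightarrow> 'a) \<Rightarrow> nat" where
  "lmo_calls \<epsilon> gradf ut X S = (LEAST k. inner_stop \<epsilon> gradf ut X S k)"

(* Termination is not assumed.  X, S and \<eta> are constrained only at indices that the loop
   reaches; X k for larger k is arbitrary. *)
definition inner_loop ::
  "step_rule \<Rightarrow> real \<Rightarrow> real \<Rightarrow> 'a::real_inner set \<Rightarrow> ('a \<Rightarrow> real) \<Rightarrow> ('a \<Rightarrow> 'a) \<Rightarrow> ('a \<Rightarrow> real) \<Rightarrow>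
   'a \<Rightarrow> 'a \<Rightarrow> (nat \<Rightarrow> 'a) \<Rightarrow> (nat \<Rightarrow> 'a) \<Rightarrow> (nat \<Rightarrow> real) \<Rightarrow> bool" where
  "inner_loop rule L \<epsilon> D f gradf g xt ut X S \<eta> \<longleftrightarrow>
     X 1 = xt \<and>
     (\<forall>k\<ge>1. (\<forall>j<k. \<not> inner_stop \<epsilon> gradf ut X S j) \<longrightarrow>
        is_arg_min (\<lambda>x. (gradf (X k) - ut) \<bullet> x) (\<lambda>x. x \<in> D) (S k) \<and>
        (\<not> inner_stop \<epsilon> gradf ut X S k \<longrightarrow>
           step_size rule L (phi_hat f g xt ut) (gradf (X k) - ut) (X k) (S k - X k) k (\<eta> k) \<and>
           X (Suc k) = X k + \<eta> k *\<^sub>R (S k - X k)))"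

(* A run of the algorithm, for an arbitrary resolution of its choices (subgradients, oracle
   answers, line search).  An outer iteration t takes place only if all the earlier inner
   loops have terminated. *)
definition dcfw_run ::
  "step_rule \<Rightarrow> real \<Rightarrow> real \<Rightarrow> 'a::real_inner set \<Rightarrow> 'a set \<Rightarrow>
   ('a \<Rightarrow> real) \<Rightarrow> ('a \<Rightarrow> 'a) \<Rightarrow> ('a \<Rightarrow> real) \<Rightarrow> 'a \<Rightarrow>
   (nat \<Rightarrow> 'a) \<Rightarrow> (nat \<Rightarrow> 'a) \<Rightarrow>
   (nat \<Rightarrow> nat \<Rightarrow> 'a) \<Rightarrow> (nat \<Rightarrow> nat \<Rightarrow> 'a) \<Rightarrow> (nat \<Rightarrow> nat \<Rightarrow> real) \<Rightarrow> bool" where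
  "dcfw_run rule L \<epsilon> D U f gradf g x0 x u X S \<eta> \<longleftrightarrow>
     x 0 = x0 \<and>
     (\<forall>t. (\<forall>s<t. inner_terminates \<epsilon> gradf (u s) (X s) (S s)) \<longrightarrow>
        u t \<in> subdifferential U g (x t) \<and>
        inner_loop rule L \<epsilon> D f gradf g (x t) (u t) (X t) (S t) (\<eta> t) \<and>
        (inner_terminates \<epsilon> gradf (u t) (X t) (S t) \<longrightarrow>
           x (Suc t) = X t (lmo_calls \<epsilon> gradf (u t) (X t) (S t))))"

end

theory Submission
  imports Defs
begin

text \<open>
  All three step-size rules decrease the model function at least as much as the
  quadratic upper bound evaluated at the open-loop step 2 / (k + 1) predicts, so a single
  recurrence covers them. It yields a suboptimality of order 1 / k, and summing it over
  k = m, \<dots>, 2 m - 1 bounds the smallest Frank--Wolfe gap in that range by 4 M / m, where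
  M is L times the squared diameter. Each inner loop thus stops after O(1 / \<epsilon>) oracle calls,
  with a constant that does not depend on its starting point because the first step already
  brings the suboptimality below M / 2.

  For the outer loop, linearising g at the current iterate majorises f - g with equality at
  that iterate, so that the DC gap is at most the decrease of f - g plus the inner accuracy
  \<epsilon> / 2; these decreases telescope.
\<close>

section \<open>Scalar recurrences behind the Frank-Wolfe rates\<close>

text \<open>Here \<open>e\<close> stands for the suboptimality and \<open>G\<close> for the
  Frank-Wolfe gap. Replacing \<open>G k\<close> by its lower bound \<open>e k\<close> turns the step
  into a contraction by the factor 1 - 2 / (k + 1) plus a quadratic error. The range starts at 2
  because the step at k = 1 has length 1 and cancels \<open>e 1\<close>.\<close>

lemma frank_wolfe_suboptimality:
  fixes e G :: "nat \<Rightarrow> real"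
  assumes step: "\<And>k. 1 \<le> k \<Longrightarrow> k < n \<Longrightarrow>
      e (Suc k) \<le> e k - 2 / (real k + 1) * G k + (2 / (real k + 1))\<^sup>2 * M / 2"
    and gap: "\<And>k. 1 \<le> k \<Longrightarrow> k < n \<Longrightarrow> e k \<le> G k"
    and M: "0 \<le> M"
    and k: "2 \<le> k" "k \<le> n"
  shows "e k \<le> 2 * M / real k"
  using k
proof (induction k rule: dec_induct)
  case base
  have "e (Suc 1) \<le> e 1 - 2 / (real 1 + 1) * G 1 + (2 / (real 1 + 1))\<^sup>2 * M / 2"
    using base by (intro step) auto
  moreover have "e 1 \<le> G 1"
    using base by (intro gap) auto
  ultimately show ?case
    using M by (simp add: numeral_2_eq_2)
next
  case (step k)
  define s where "s = 2 / (real k + 1)"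
  have s: "0 \<le> s" "s \<le> 1"
    using step.hyps by (auto simp: s_def)
  have "e (Suc k) \<le> e k - s * G k + s\<^sup>2 * M / 2"
    using step.hyps step.prems assms(1)[of k] unfolding s_def by auto
  also have "\<dots> \<le> (1 - s) * e k + s\<^sup>2 * M / 2"
    using mult_left_mono[OF gap[of k] s(1)] step.hyps step.prems by (simp add: algebra_simps)
  also have "\<dots> \<le> (1 - s) * (2 * M / real k) + s\<^sup>2 * M / 2"
    using mult_left_mono[of "e k" "2 * M / real k" "1 - s"] step.IH step.prems s by simp
  also have "\<dots> = 2 * M * ((real k - 1) / (real k * (real k + 1)) + 1 / (real k + 1)\<^sup>2)"
  proof -
    have "1 - s = (real k - 1) / (real k + 1)"
      by (simp add: s_def field_simps)
    then have "(1 - s) * (2 * M / real k) = 2 * M * ((real k - 1) / (real k * (real k + 1)))"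
      by (simp add: mult.commute)
    moreover have "s\<^sup>2 * M / 2 = 2 * M * (1 / (real k + 1)\<^sup>2)"
      by (simp add: s_def power_divide)
    ultimately show ?thesis
      by (simp add: distrib_left)
  qed
  \<comment> \<open>Multiplied by k + 1, the remaining inequality is (k - 1) / k + 1 / (k + 1) \<le>
    1, that is 1 / (k + 1) \<le> 1 / k.\<close>
  also have "\<dots> \<le> 2 * M * (1 / (real k + 1))"
  proof (rule mult_left_mono)
    show "(real k - 1) / (real k * (real k + 1)) + 1 / (real k + 1)\<^sup>2 \<le> 1 / (real k + 1)"
      using step.hyps by (simp add: divide_simps power2_eq_square) (simp add: algebra_simps)
  qed (use M in simp)
  finally show ?case
    by (simp add: add.commute)
qed

text \<open>Over the m steps from \<open>m\<close> to \<open>2 * m\<close>, gaps of at least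
  \<delta> force a total decrease of \<delta>, up to quadratic errors that telescope. The bound on
  \<open>e m\<close> limits how much decrease is available.\<close>

lemma frank_wolfe_gap_bound:
  fixes e G :: "nat \<Rightarrow> real"
  assumes step: "\<And>k. 1 \<le> k \<Longrightarrow> k < 2 * m \<Longrightarrow>
      e (Suc k) \<le> e k - 2 / (real k + 1) * G k + (2 / (real k + 1))\<^sup>2 * M / 2"
    and gap: "\<And>k. 1 \<le> k \<Longrightarrow> k < 2 * m \<Longrightarrow> e k \<le> G k"
    and large: "\<And>k. 1 \<le> k \<Longrightarrow> k < 2 * m \<Longrightarrow> \<delta> \<le> G k"
    and M: "0 \<le> M" and \<delta>: "0 \<le> \<delta>" and m: "2 \<le> m"
    and last: "0 \<le> e (2 * m)"
  shows "\<delta> \<le> 4 * M / real m"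
proof -
  have em: "e m \<le> 2 * M / real m"
    using frank_wolfe_suboptimality[OF step gap M m] by simp
  \<comment> \<open>The potential e k + 2 M / k is at most 4 M / m at k = m and drops by at least
    \<delta> / m in each step.\<close>
  have "e (m + j) + real j * \<delta> / real m \<le> 4 * M / real m - 2 * M / real (m + j)"
    if "j \<le> m" for j
    using that
  proof (induction j)
    case 0
    then show ?case using em by simp
  next
    case (Suc j)
    define k where "k = m + j"
    have k: "1 \<le> k" "k < 2 * m" "real k > 0"
      using Suc.prems m by (auto simp: k_def)
    \<comment> \<open>This is k + 1 \<le> 2 m, the reason for ending the window at
      \<open>2 * m\<close>.\<close>
    have "1 / real m \<le> 2 / (real k + 1)"
      using k m by (simp add: field_simps)
    then have "1 / real m * \<delta> \<le> 2 / (real k + 1) * G k"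
      using large[OF k(1,2)] \<delta> by (intro mult_mono) auto
    moreover have "1 / (real k + 1)\<^sup>2 \<le> 1 / real k - 1 / real (Suc k)"
      using k by (simp add: divide_simps power2_eq_square) (simp add: algebra_simps)
    from mult_left_mono[OF this, of "2 * M"]
    have "(2 / (real k + 1))\<^sup>2 * M / 2 \<le> 2 * M / real k - 2 * M / real (Suc k)"
      using M by (simp add: power_divide right_diff_distrib)
    ultimately have "e (Suc k) + \<delta> / real m \<le> e k + 2 * M / real k - 2 * M / real (Suc k)"
      using step[OF k(1,2)] by simp
    moreover have "e k + real j * \<delta> / real m \<le> 4 * M / real m - 2 * M / real k"
      using Suc by (simp add: k_def)
    moreover have "real (Suc j) * \<delta> / real m = real j * \<delta> / real m + \<delta> / real m"
      by (simp add: add_divide_distrib distrib_right)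
    ultimately show ?case
      unfolding k_def add_Suc_right by linarith
  qed
  from this[of m, folded mult_2] m have "e (2 * m) + \<delta> \<le> 4 * M / real m - 2 * M / real (2 * m)"
    by simp
  moreover have "0 \<le> 2 * M / real (2 * m)"
    using M by simp
  ultimately show ?thesis
    using last by linarith
qed

text \<open>The parabola - s G + s^2 Q / 2 is minimised over [0, 1] at its vertex G / Q, truncated
  to 1. For \<open>Q = 0\<close> it degenerates to a nonincreasing line, minimised at 1.\<close>

lemma demyanov_rubinov_step_optimal:
  fixes G Q s :: real
  assumes "0 \<le> G" "0 \<le> Q" "0 \<le> s" "s \<le> 1"
    and \<eta>: "\<eta> = (if Q = 0 then 1 else min (G / Q) 1)"
  shows "- \<eta> * G + \<eta>\<^sup>2 * Q / 2 \<le> - s * G + s\<^sup>2 * Q / 2"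
proof (cases "Q = 0")
  case True
  then show ?thesis
    using assms by (simp add: mult_left_le_one_le)
next
  case False
  then have Q: "0 < Q"
    using assms by simp
  show ?thesis
  proof (cases "G \<le> Q")
    case True
    then have "\<eta> = G / Q"
      using \<eta> Q by (simp add: min_def)
    then have "- s * G + s\<^sup>2 * Q / 2 - (- \<eta> * G + \<eta>\<^sup>2 * Q / 2) = Q / 2 * (s - G / Q)\<^sup>2"
      unfolding \<open>\<eta> = G / Q\<close> using Q by (simp add: field_simps power2_eq_square)
    moreover have "0 \<le> Q / 2 * (s - G / Q)\<^sup>2"
      using Q by simp
    ultimately show ?thesis
      by linarith
  next
    case False
    then have "\<eta> = 1"
      using \<eta> Q by (simp add: min_def)
    \<comment> \<open>The vertex lies beyond 1, so the difference factors into terms that are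
      nonnegative for s \<le> 1.\<close>
    then have "- s * G + s\<^sup>2 * Q / 2 - (- \<eta> * G + \<eta>\<^sup>2 * Q / 2)
        = (1 - s) * ((G - Q) + Q * (1 - s) / 2)"
      by (simp add: field_simps power2_eq_square)
    moreover have "0 \<le> (1 - s) * ((G - Q) + Q * (1 - s) / 2)"
      using False assms by (intro mult_nonneg_nonneg add_nonneg_nonneg) auto
    ultimately show ?thesis
      by linarith
  qed
qed

section \<open>Subdifferentials and the DC gap\<close>

text \<open>A real \<open>INF\<close> lies below its values only if they are bounded below. Openness
  of \<open>U\<close> leaves room for a short step from \<open>y\<close> along \<open>w\<close>, and
  the subgradient inequality at its end bounds u . w uniformly in u.\<close>

lemma subdifferential_gap_bdd_below:
  fixes g :: "'a::real_inner \<Rightarrow> real"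
  assumes "open U" "y \<in> U"
  shows "bdd_below ((\<lambda>u. c - u \<bullet> w) ` subdifferential U g y)"
proof -
  have "((\<lambda>r. y + r *\<^sub>R w) \<longlongrightarrow> y + 0 *\<^sub>R w) (at_right 0)"
    by (intro tendsto_intros)
  then have "\<forall>\<^sub>F r in at_right 0. y + r *\<^sub>R w \<in> U"
    using assms by (intro topological_tendstoD) auto
  moreover have "\<forall>\<^sub>F r in at_right (0::real). r > 0"
    by (simp add: eventually_at_right_less)
  ultimately have "\<forall>\<^sub>F r in at_right 0. y + r *\<^sub>R w \<in> U \<and> r > 0"
    by eventually_elim auto
  then obtain r where r: "y + r *\<^sub>R w \<in> U" "r > 0"
    using eventually_happens[of _ "at_right (0::real)"] by auto
  show ?thesis
  proof (rule bdd_belowI2)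
    fix u assume "u \<in> subdifferential U g y"
    then have "g (y + r *\<^sub>R w) \<ge> g y + u \<bullet> (r *\<^sub>R w)"
      using r by (auto simp: subdifferential_def)
    then have "u \<bullet> w \<le> (g (y + r *\<^sub>R w) - g y) / r"
      using r by (simp add: field_simps)
    then show "c - (g (y + r *\<^sub>R w) - g y) / r \<le> c - u \<bullet> w"
      by simp
  qed
qed

text \<open>The inner minimum is at most its value at any one subgradient, so the one picked by the
  algorithm suffices to bound the gap.\<close>

lemma gap_DC_le:
  fixes g :: "'a::real_inner \<Rightarrow> real"
  assumes "open U" "y \<in> U" "D \<noteq> {}" "u \<in> subdifferential U g y"
    and "\<And>x. x \<in> D \<Longrightarrow> f y - f x - u \<bullet> (y - x) \<le> c"
  shows "gap_DC D U f g y \<le> c"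
  unfolding gap_DC_def
proof (rule cSUP_least[OF assms(3)])
  fix x assume "x \<in> D"
  have "(INF v\<in>subdifferential U g y. f y - f x - v \<bullet> (y - x)) \<le> f y - f x - u \<bullet> (y - x)"
    using assms by (intro cINF_lower subdifferential_gap_bdd_below)
  also have "\<dots> \<le> c"
    using assms \<open>x \<in> D\<close> by blast
  finally show "(INF v\<in>subdifferential U g y. f y - f x - v \<bullet> (y - x)) \<le> c" .
qed

section \<open>Smooth convex functions and a single Frank-Wolfe step\<close>

text \<open>Derivatives are taken within \<open>D\<close>, which may have empty interior; they are
  used only along segments contained in \<open>D\<close>.\<close>

locale smooth_convex_function =
  fixes D :: "'a::euclidean_space set" and f :: "'a \<Rightarrow> real" and gradf :: "'a \<Rightarrow> 'a" and L :: real
  assumes convex_D: "convex D" and bounded_D: "bounded D"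
    and convex_f: "convex_on D f"
    and derivative_f: "\<And>y. y \<in> D \<Longrightarrow> (f has_derivative (\<lambda>h. gradf y \<bullet> h)) (at y within D)"
    and lipschitz: "L-lipschitz_on D gradf"
begin

lemma L_nonneg: "0 \<le> L"
  using lipschitz by (rule lipschitz_on_nonneg)

lemma segment_in_D: "x \<in> D \<Longrightarrow> y \<in> D \<Longrightarrow> s \<in> {0..1} \<Longrightarrow> x + s *\<^sub>R (y - x) \<in> D"
  using convexD_alt[OF convex_D, of x y s] by (simp add: algebra_simps)

lemma derivative_along_segment:
  assumes "x \<in> D" "y \<in> D" "s \<in> {0..1}"
  shows "((\<lambda>s. f (x + s *\<^sub>R (y - x))) has_real_derivative gradf (x + s *\<^sub>R (y - x)) \<bullet> (y - x))
    (at s within {0..1})"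
proof -
  let ?p = "\<lambda>s. x + s *\<^sub>R (y - x)"
  have "(f has_derivative (\<lambda>h. gradf (?p s) \<bullet> h)) (at (?p s) within ?p ` {0..1})"
    using segment_in_D assms by (intro has_derivative_subset[OF derivative_f]) auto
  moreover have "(?p has_derivative (\<lambda>h. h *\<^sub>R (y - x))) (at s within {0..1})"
    by (auto intro!: derivative_eq_intros)
  ultimately have "(f \<circ> ?p has_derivative (\<lambda>h. gradf (?p s) \<bullet> h) \<circ> (\<lambda>h. h *\<^sub>R (y - x)))
      (at s within {0..1})"
    by (intro diff_chain_within)
  then show ?thesis
    by (simp add: has_field_derivative_def o_def mult.commute[of _ "gradf _ \<bullet> _"])
qed

text \<open>Convexity bounds every difference quotient along the segment by f y - f x; the limit at
  0 is the directional derivative.\<close>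

lemma above_tangent:
  assumes "x \<in> D" "y \<in> D"
  shows "f x + gradf x \<bullet> (y - x) \<le> f y"
proof -
  let ?p = "\<lambda>s. f (x + s *\<^sub>R (y - x))"
  have "((\<lambda>s. (?p s - ?p 0) / (s - 0)) \<longlongrightarrow> gradf x \<bullet> (y - x)) (at 0 within {0..1})"
    using derivative_along_segment[OF assms, of 0] by (simp add: has_field_derivative_iff)
  moreover have "\<forall>\<^sub>F s in at 0 within {0..1}. (?p s - ?p 0) / (s - 0) \<le> f y - f x"
    unfolding eventually_at_filter
  proof (intro always_eventually allI impI)
    fix s :: real assume s: "s \<noteq> 0" "s \<in> {0..1}"
    then have "?p s \<le> (1 - s) * f x + s * f y"
      using convex_onD[OF convex_f, of s x y] assms by (simp add: algebra_simps)
    then show "(?p s - ?p 0) / (s - 0) \<le> f y - f x"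
      using s by (simp add: field_simps)
  qed
  moreover have "at (0::real) within {0..1} \<noteq> bot"
    by (simp add: at_within_Icc_at_right)
  ultimately have "gradf x \<bullet> (y - x) \<le> f y - f x"
    by (intro tendsto_upperbound)
  then show ?thesis
    by simp
qed

text \<open>Subtracting the tangent and the quadratic term along the segment leaves a function whose
  derivative is nonpositive, by Cauchy-Schwarz and the Lipschitz bound. Comparing its endpoints
  takes the place of integration.\<close>

lemma descent:
  assumes "x \<in> D" "y \<in> D"
  shows "f y \<le> f x + gradf x \<bullet> (y - x) + L / 2 * (norm (y - x))\<^sup>2"
proof -
  let ?d = "y - x"
  let ?p = "\<lambda>s. f (x + s *\<^sub>R ?d) - s * (gradf x \<bullet> ?d) - L / 2 * s\<^sup>2 * (norm ?d)\<^sup>2"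
  have deriv: "(?p has_real_derivative
      (gradf (x + s *\<^sub>R ?d) \<bullet> ?d - gradf x \<bullet> ?d - L * s * (norm ?d)\<^sup>2)) (at s within {0..1})"
    if "s \<in> {0..1}" for s
    by (rule derivative_eq_intros derivative_along_segment[OF assms that] refl | simp)+
  have nonpos: "gradf (x + s *\<^sub>R ?d) \<bullet> ?d - gradf x \<bullet> ?d - L * s * (norm ?d)\<^sup>2 \<le> 0"
    if "s \<in> {0..1}" for s
  proof -
    have "(gradf (x + s *\<^sub>R ?d) - gradf x) \<bullet> ?d \<le> norm (gradf (x + s *\<^sub>R ?d) - gradf x) * norm ?d"
      by (rule norm_cauchy_schwarz)
    also have "\<dots> \<le> (L * norm (s *\<^sub>R ?d)) * norm ?d"
      using lipschitz_onD[OF lipschitz segment_in_D[OF assms that] assms(1)]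
      by (intro mult_right_mono) (auto simp: dist_norm)
    also have "\<dots> = L * s * (norm ?d)\<^sup>2"
      using that by (simp add: power2_eq_square)
    finally show ?thesis
      by (simp add: inner_diff_left)
  qed
  have "?p 1 \<le> ?p 0"
  proof (rule DERIV_nonpos_imp_decreasing_open[where f = ?p])
    show "\<exists>z. (?p has_real_derivative z) (at s) \<and> z \<le> 0" if "0 < s" "s < 1" for s
      using deriv[of s] nonpos[of s] that by (auto simp: at_within_Icc_at)
    show "continuous_on {0..1} ?p"
      using deriv by (rule DERIV_continuous_on)
  qed simp
  then show ?thesis
    by simp
qed

text \<open>\<open>phi_hat\<close> differs from \<open>f\<close> by an affine function and thus
  inherits the tangent inequality, with gradient \<open>gradf x - u\<close>.\<close>

lemma model_below_tangent:
  assumes "x \<in> D" "y \<in> D"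
  shows "phi_hat f g c u x - phi_hat f g c u y \<le> - ((gradf x - u) \<bullet> (y - x))"
  using above_tangent[OF assms] by (simp add: phi_hat_def inner_diff_left inner_diff_right)

text \<open>The bound contains the open-loop step whatever the rule: line search does at least as
  well as that step, and the Demyanov-Rubinov step minimises the quadratic upper bound over
  [0, 1].\<close>

lemma frank_wolfe_step:
  assumes x: "x \<in> D" and y: "y \<in> D" and k: "1 \<le> k"
    and G: "0 \<le> - ((gradf x - u) \<bullet> (y - x))"
    and step: "step_size rule L (phi_hat f g c u) (gradf x - u) x (y - x) k \<eta>"
  shows "x + \<eta> *\<^sub>R (y - x) \<in> D"
    and "phi_hat f g c u (x + \<eta> *\<^sub>R (y - x)) \<le> phi_hat f g c u x
      - 2 / (real k + 1) * (- ((gradf x - u) \<bullet> (y - x)))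
      + (2 / (real k + 1))\<^sup>2 * (L * (diameter D)\<^sup>2) / 2"
proof -
  define h where "h = phi_hat f g c u"
  define G where "G = - ((gradf x - u) \<bullet> (y - x))"
  define Q where "Q = L * (norm (y - x))\<^sup>2"
  define s where "s = 2 / (real k + 1)"
  have s: "s \<in> {0..1}"
    using k by (auto simp: s_def)
  have Q: "0 \<le> Q" "Q \<le> L * (diameter D)\<^sup>2"
    using L_nonneg diameter_bounded_bound[OF bounded_D y x]
    by (auto simp: Q_def dist_norm intro!: mult_left_mono power_mono)
  have upper: "h (x + r *\<^sub>R (y - x)) \<le> h x - r * G + r\<^sup>2 * Q / 2" if "r \<in> {0..1}" for r
    using descent[OF x segment_in_D[OF x y that]]
    by (simp add: h_def G_def Q_def phi_hat_def inner_diff_left inner_diff_right inner_add_right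
        power_mult_distrib ring_distribs mult.left_commute)
  have "\<eta> \<in> {0..1} \<and> h (x + \<eta> *\<^sub>R (y - x)) \<le> h x - s * G + s\<^sup>2 * Q / 2"
  proof (cases rule)
    case Open_Loop
    then have "\<eta> = s"
      using step by (simp add: s_def)
    then show ?thesis
      using s upper by auto
  next
    case Line_Search
    then have "\<eta> \<in> {0..1}" "h (x + \<eta> *\<^sub>R (y - x)) \<le> h (x + s *\<^sub>R (y - x))"
      using step s by (auto simp: is_arg_min_linorder h_def)
    then show ?thesis
      using upper[OF s] by auto
  next
    case Demyanov_Rubinov
    then have \<eta>: "\<eta> = (if Q = 0 then 1 else min (G / Q) 1)"
      using step by (simp add: Q_def G_def)
    moreover have "0 \<le> G / Q"
      using Q G by (simp only: G_def divide_nonneg_nonneg)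
    ultimately have "\<eta> \<in> {0..1}"
      by auto
    moreover have "- \<eta> * G + \<eta>\<^sup>2 * Q / 2 \<le> - s * G + s\<^sup>2 * Q / 2"
      using G Q s \<eta> by (intro demyanov_rubinov_step_optimal) (auto simp: G_def)
    ultimately show ?thesis
      using upper[of \<eta>] by auto
  qed
  \<comment> \<open>The diameter enters only now, since the Demyanov-Rubinov rule is optimal for the
    quadratic with the actual length of the direction.\<close>
  moreover have "s\<^sup>2 * Q / 2 \<le> s\<^sup>2 * (L * (diameter D)\<^sup>2) / 2"
    using Q by (intro divide_right_mono mult_left_mono) auto
  ultimately have "\<eta> \<in> {0..1}"
    and "h (x + \<eta> *\<^sub>R (y - x)) \<le> h x - s * G + s\<^sup>2 * (L * (diameter D)\<^sup>2) / 2"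
    by auto
  then show "x + \<eta> *\<^sub>R (y - x) \<in> D"
    and "phi_hat f g c u (x + \<eta> *\<^sub>R (y - x)) \<le> phi_hat f g c u x
      - 2 / (real k + 1) * (- ((gradf x - u) \<bullet> (y - x)))
      + (2 / (real k + 1))\<^sup>2 * (L * (diameter D)\<^sup>2) / 2"
    using segment_in_D[OF x y] unfolding h_def G_def s_def by blast+
qed

section \<open>The inner loop\<close>

lemma inner_loop_iterate_in_D:
  assumes loop: "inner_loop rule L \<epsilon> D f gradf g xt ut X S \<eta>" and xt: "xt \<in> D" and \<epsilon>: "\<epsilon> > 0"
    and "1 \<le> k" and "\<forall>j<k. \<not> inner_stop \<epsilon> gradf ut X S j"
  shows "X k \<in> D"
  using assms(4,5)
proof (induction k rule: dec_induct)
  case base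
  then show ?case
    using loop xt by (simp add: inner_loop_def)
next
  case (step k)
  then have X: "X k \<in> D" and go: "\<not> inner_stop \<epsilon> gradf ut X S k"
    by auto
  have "S k \<in> D"
    and size: "step_size rule L (phi_hat f g xt ut) (gradf (X k) - ut) (X k) (S k - X k) k (\<eta> k)"
    and next_iterate: "X (Suc k) = X k + \<eta> k *\<^sub>R (S k - X k)"
    using loop step.hyps step.prems by (auto simp: inner_loop_def is_arg_min_def)
  moreover have "0 \<le> - ((gradf (X k) - ut) \<bullet> (S k - X k))"
    using go step.hyps \<epsilon> by (simp add: inner_stop_def)
  ultimately show ?case
    using frank_wolfe_step(1)[OF X] step.hyps by fastforce
qed

text \<open>Without a stop up to index 2 m, all gaps in that range would exceed \<epsilon> / 2,
  contradicting the bound 4 M / m on the smallest one.\<close>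

lemma inner_loop_stops:
  assumes loop: "inner_loop rule L \<epsilon> D f gradf g xt ut X S \<eta>" and xt: "xt \<in> D" and \<epsilon>: "\<epsilon> > 0"
  shows "\<exists>k. inner_stop \<epsilon> gradf ut X S k \<and> real k \<le> 16 * (L * (diameter D)\<^sup>2) / \<epsilon> + 4"
proof (rule ccontr)
  define M where "M = L * (diameter D)\<^sup>2"
  \<comment> \<open>Any m > 8 M / \<epsilon> gives 4 M / m < \<epsilon> / 2. Adding 2 also ensures m
    \<ge> 2, and doubling yields the bound 16 M / \<epsilon> + 4.\<close>
  define m where "m = nat \<lfloor>8 * M / \<epsilon>\<rfloor> + 2"
  define G where "G = (\<lambda>k. - ((gradf (X k) - ut) \<bullet> (S k - X k)))"
  \<comment> \<open>The reference point is the last iterate of the window instead of a minimiser: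
    \<open>e (2 * m)\<close> is then 0, and \<open>e k \<le> G k\<close> holds against any point of
    \<open>D\<close>.\<close>
  define e where "e = (\<lambda>k. phi_hat f g xt ut (X k) - phi_hat f g xt ut (X (2 * m)))"
  have M: "0 \<le> M"
    using L_nonneg by (simp add: M_def)
  have m: "8 * M / \<epsilon> < real m" "real m \<le> 8 * M / \<epsilon> + 2" "2 \<le> m"
    using M \<epsilon> unfolding m_def by auto linarith+
  assume "\<nexists>k. inner_stop \<epsilon> gradf ut X S k \<and> real k \<le> 16 * (L * (diameter D)\<^sup>2) / \<epsilon> + 4"
  moreover have "real k \<le> 16 * M / \<epsilon> + 4" if "k \<le> 2 * m" for k
  proof -
    have "real k \<le> 2 * real m"
      using that by linarith
    then show ?thesis
      using m(2) by simp
  qed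
  ultimately have go: "\<not> inner_stop \<epsilon> gradf ut X S k" if "k \<le> 2 * m" for k
    using that unfolding M_def by blast
  have X: "X k \<in> D" if "1 \<le> k" "k \<le> 2 * m" for k
    using inner_loop_iterate_in_D[OF loop xt \<epsilon> that(1)] go that by auto
  have loopD: "is_arg_min (\<lambda>x. (gradf (X k) - ut) \<bullet> x) (\<lambda>x. x \<in> D) (S k)"
    "step_size rule L (phi_hat f g xt ut) (gradf (X k) - ut) (X k) (S k - X k) k (\<eta> k)"
    "X (Suc k) = X k + \<eta> k *\<^sub>R (S k - X k)" if "1 \<le> k" "k < 2 * m" for k
    using loop go that unfolding inner_loop_def by auto
  have S: "S k \<in> D" if "1 \<le> k" "k < 2 * m" for k
    using loopD(1)[OF that] by (simp add: is_arg_min_def)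
  have large: "\<epsilon> / 2 \<le> G k" if "1 \<le> k" "k < 2 * m" for k
    using go[of k] that by (simp add: inner_stop_def G_def)
  have "\<epsilon> / 2 \<le> 4 * M / real m"
  proof (rule frank_wolfe_gap_bound[OF _ _ large M _ m(3)])
    fix k assume k: "1 \<le> k" "k < 2 * m"
    have "0 \<le> - ((gradf (X k) - ut) \<bullet> (S k - X k))"
      using large[OF k] \<epsilon> by (simp add: G_def)
    from frank_wolfe_step(2)[OF X S k(1) this loopD(2)] k
    show "e (Suc k) \<le> e k - 2 / (real k + 1) * G k + (2 / (real k + 1))\<^sup>2 * M / 2"
      by (simp add: e_def G_def M_def loopD(3))
    have "e k \<le> - ((gradf (X k) - ut) \<bullet> (X (2 * m) - X k))"
      unfolding e_def using X k by (intro model_below_tangent) auto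
    also have "\<dots> \<le> G k"
      using loopD(1)[OF k] X[of "2 * m"] k
      by (auto simp: G_def is_arg_min_linorder inner_diff_right)
    finally show "e k \<le> G k" .
  qed (use \<epsilon> in \<open>auto simp: e_def\<close>)
  moreover have "4 * M / real m < \<epsilon> / 2"
    using m \<epsilon> by (simp add: field_simps)
  ultimately show False
    by simp
qed

text \<open>At the first stopping index the oracle answer is still constrained. The test therefore
  bounds the linear gap against every point of \<open>D\<close>, which the tangent inequality turns
  into \<epsilon> / 2-optimality for the model.\<close>

lemma inner_loop_result:
  assumes loop: "inner_loop rule L \<epsilon> D f gradf g xt ut X S \<eta>" and xt: "xt \<in> D" and \<epsilon>: "\<epsilon> > 0"
  defines "n \<equiv> lmo_calls \<epsilon> gradf ut X S"
  shows "inner_terminates \<epsilon> gradf ut X S"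
    and "real n \<le> 16 * (L * (diameter D)\<^sup>2) / \<epsilon> + 4"
    and "X n \<in> D"
    and "\<And>y. y \<in> D \<Longrightarrow> phi_hat f g xt ut (X n) - phi_hat f g xt ut y \<le> \<epsilon> / 2"
proof -
  obtain k where k: "inner_stop \<epsilon> gradf ut X S k"
    "real k \<le> 16 * (L * (diameter D)\<^sup>2) / \<epsilon> + 4"
    using inner_loop_stops[OF loop xt \<epsilon>] by blast
  then show "inner_terminates \<epsilon> gradf ut X S"
    by (auto simp: inner_terminates_def)
  have "n \<le> k"
    using k(1) by (auto simp: n_def lmo_calls_def intro: Least_le)
  then show "real n \<le> 16 * (L * (diameter D)\<^sup>2) / \<epsilon> + 4"
    using k(2) by linarith
  have stop: "inner_stop \<epsilon> gradf ut X S n"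
    unfolding n_def lmo_calls_def using k(1) by (rule LeastI)
  then have n: "1 \<le> n"
    by (simp add: inner_stop_def)
  have go: "\<forall>j<n. \<not> inner_stop \<epsilon> gradf ut X S j"
    by (auto simp: n_def lmo_calls_def dest: not_less_Least)
  show Xn: "X n \<in> D"
    using inner_loop_iterate_in_D[OF loop xt \<epsilon> n go] .
  have "is_arg_min (\<lambda>x. (gradf (X n) - ut) \<bullet> x) (\<lambda>x. x \<in> D) (S n)"
    using loop n go by (auto simp: inner_loop_def)
  then have "- ((gradf (X n) - ut) \<bullet> (y - X n)) \<le> \<epsilon> / 2" if "y \<in> D" for y
    using stop that by (force simp: is_arg_min_linorder inner_stop_def inner_diff_right)
  then show "phi_hat f g xt ut (X n) - phi_hat f g xt ut y \<le> \<epsilon> / 2" if "y \<in> D" for y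
    using model_below_tangent[OF Xn that, of g xt ut] that by force
qed

section \<open>The outer loop\<close>

text \<open>Both claims need a joint induction: iteration \<open>t\<close> is constrained only once
  all earlier inner loops have terminated, and termination relies on \<open>x t\<close> lying in
  \<open>D\<close>.\<close>

lemma dcfw_run_invariant:
  assumes run: "dcfw_run rule L \<epsilon> D U f gradf g x0 x u X S \<eta>" and x0: "x0 \<in> D" and \<epsilon>: "\<epsilon> > 0"
  shows "x t \<in> D \<and> (\<forall>s<t. inner_terminates \<epsilon> gradf (u s) (X s) (S s))"
proof (induction t)
  case 0
  then show ?case
    using run x0 by (simp add: dcfw_run_def)
next
  case (Suc t)
  then have loop: "inner_loop rule L \<epsilon> D f gradf g (x t) (u t) (X t) (S t) (\<eta> t)"
    and "inner_terminates \<epsilon> gradf (u t) (X t) (S t) \<Longrightarrow>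
      x (Suc t) = X t (lmo_calls \<epsilon> gradf (u t) (X t) (S t))"
    using run by (auto simp: dcfw_run_def)
  with inner_loop_result[OF loop _ \<epsilon>] Suc show ?case
    by (auto simp: less_Suc_eq)
qed

lemma dcfw_run_step:
  assumes run: "dcfw_run rule L \<epsilon> D U f gradf g x0 x u X S \<eta>" and x0: "x0 \<in> D" and \<epsilon>: "\<epsilon> > 0"
    and U: "open U" "D \<subseteq> U"
  shows "inner_terminates \<epsilon> gradf (u t) (X t) (S t)"
    and "real (lmo_calls \<epsilon> gradf (u t) (X t) (S t)) \<le> 16 * (L * (diameter D)\<^sup>2) / \<epsilon> + 4"
    and "gap_DC D U f g (x t) \<le> f (x t) - g (x t) - (f (x (Suc t)) - g (x (Suc t))) + \<epsilon> / 2"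
proof -
  have xt: "x t \<in> D" "x (Suc t) \<in> D"
    using dcfw_run_invariant[OF run x0 \<epsilon>] by auto
  show terminates: "inner_terminates \<epsilon> gradf (u t) (X t) (S t)"
    using dcfw_run_invariant[OF run x0 \<epsilon>, of "Suc t"] by auto
  have u: "u t \<in> subdifferential U g (x t)"
    and loop: "inner_loop rule L \<epsilon> D f gradf g (x t) (u t) (X t) (S t) (\<eta> t)"
    and Suc_t: "x (Suc t) = X t (lmo_calls \<epsilon> gradf (u t) (X t) (S t))"
    using run dcfw_run_invariant[OF run x0 \<epsilon>, of t] terminates by (auto simp: dcfw_run_def)
  note result = inner_loop_result[OF loop xt(1) \<epsilon>, folded Suc_t]
  show "real (lmo_calls \<epsilon> gradf (u t) (X t) (S t)) \<le> 16 * (L * (diameter D)\<^sup>2) / \<epsilon> + 4"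
    by (rule result)
  show "gap_DC D U f g (x t) \<le> f (x t) - g (x t) - (f (x (Suc t)) - g (x (Suc t))) + \<epsilon> / 2"
  proof (rule gap_DC_le[OF U(1) _ _ u])
    fix y assume "y \<in> D"
    \<comment> \<open>Hence the model at \<open>x (Suc t)\<close> is at least f - g there, while
      both agree at \<open>x t\<close>. The decrease of the model is thus at most that of f - g, and
      passing on to \<open>y\<close> costs at most \<epsilon> / 2.\<close>
    have "g (x t) + u t \<bullet> (x (Suc t) - x t) \<le> g (x (Suc t))"
      using u xt U by (auto simp: subdifferential_def)
    then show "f (x t) - f y - u t \<bullet> (x t - y)
        \<le> f (x t) - g (x t) - (f (x (Suc t)) - g (x (Suc t))) + \<epsilon> / 2"
      using result(4)[OF \<open>y \<in> D\<close>] by (simp add: phi_hat_def inner_diff_right)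
  qed (use xt U in auto)
qed

end

section \<open>Iteration and oracle complexity\<close>

theorem corollary4:
  shows "\<exists>C1 C2 :: real \<Rightarrow> real \<Rightarrow> real \<Rightarrow> real.
    \<forall>(D :: 'a::euclidean_space set) U f gradf g L \<epsilon> rule x0 x u X S \<eta>.
      D \<noteq> {} \<and> convex D \<and> compact D \<and>
      convex_on D f \<and>
      (\<forall>y\<in>D. (f has_derivative (\<lambda>h. gradf y \<bullet> h)) (at y within D)) \<and>
      L-lipschitz_on D gradf \<and>
      open U \<and> convex U \<and> D \<subseteq> U \<and> convex_on U g \<and>
      \<epsilon> > 0 \<and> x0 \<in> D \<and>
      dcfw_run rule L \<epsilon> D U f gradf g x0 x u X S \<eta> \<longrightarrow>
      (let \<Delta> = f x0 - g x0 - (INF y\<in>D. f y - g y) in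
        (\<forall>t. inner_terminates \<epsilon> gradf (u t) (X t) (S t)) \<and>
        (\<exists>t. real t \<le> C1 L (diameter D) \<Delta> / \<epsilon> \<and>
             (MIN \<tau>\<in>{0..t}. gap_DC D U f g (x \<tau>)) \<le> \<epsilon> \<and>
             real (\<Sum>s<t. lmo_calls \<epsilon> gradf (u s) (X s) (S s))
               \<le> C2 L (diameter D) \<Delta> / \<epsilon>\<^sup>2))"
proof (rule exI[of _ "\<lambda>L d \<Delta>. 2 * \<Delta>"],
    rule exI[of _ "\<lambda>L d \<Delta>. 2 * \<Delta> * (16 * (L * d\<^sup>2) + 8 * \<Delta>)"],
    intro allI impI, elim conjE, goal_cases)
  case (1 D U f gradf g L \<epsilon> rule x0 x u X S \<eta>)
  interpret smooth_convex_function D f gradf L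
    using 1 by unfold_locales (auto intro: compact_imp_bounded)
  define \<phi> where "\<phi> = (\<lambda>y. f y - g y)"
  define \<Delta> where "\<Delta> = \<phi> x0 - (INF y\<in>D. \<phi> y)"
  \<comment> \<open>The iterates 0, ..., t number t + 1 > 2 \<Delta> / \<epsilon>. If all their gaps
    exceeded \<epsilon>, each step would lower \<phi> by at least \<epsilon> / 2, in total by more
    than \<Delta>.\<close>
  define t where "t = nat \<lfloor>2 * \<Delta> / \<epsilon>\<rfloor>"
  define calls where "calls = (\<lambda>s. lmo_calls \<epsilon> gradf (u s) (X s) (S s))"
  note \<open>\<epsilon> > 0\<close> [simp]
  note run = \<open>dcfw_run rule L \<epsilon> D U f gradf g x0 x u X S \<eta>\<close>
  note step = dcfw_run_step[OF run \<open>x0 \<in> D\<close> \<open>\<epsilon> > 0\<close> \<open>open U\<close> \<open>D \<subseteq> U\<close>]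
  have "continuous_on D f"
    unfolding continuous_on_eq_continuous_within
    using derivative_f by (blast intro: has_derivative_continuous)
  moreover have "continuous_on D g"
    using convex_on_continuous[OF \<open>open U\<close> \<open>convex_on U g\<close>] \<open>D \<subseteq> U\<close> continuous_on_subset by blast
  ultimately have "compact (\<phi> ` D)"
    unfolding \<phi>_def using \<open>compact D\<close> by (intro compact_continuous_image continuous_intros)
  then have bdd: "bdd_below (\<phi> ` D)"
    by (intro bounded_imp_bdd_below compact_imp_bounded)
  have inf_le: "(INF y\<in>D. \<phi> y) \<le> \<phi> y" if "y \<in> D" for y
    using bdd that by (rule cINF_lower)
  have x_in: "x s \<in> D" for s
    using dcfw_run_invariant[OF run \<open>x0 \<in> D\<close> \<open>\<epsilon> > 0\<close>] by blast
  have x_0: "x 0 = x0"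
    using run by (simp add: dcfw_run_def)
  have \<Delta>: "0 \<le> \<Delta>"
    using inf_le[OF \<open>x0 \<in> D\<close>] by (simp add: \<Delta>_def)
  have "0 \<le> 2 * \<Delta> / \<epsilon>"
    using \<Delta> by (intro divide_nonneg_pos) auto
  then have "real t = of_int \<lfloor>2 * \<Delta> / \<epsilon>\<rfloor>"
    unfolding t_def by (simp only: of_nat_nat zero_le_floor)
  then have t: "real t \<le> 2 * \<Delta> / \<epsilon>" "2 * \<Delta> / \<epsilon> < real (Suc t)"
    by linarith+
  have min_gap: "(MIN \<tau>\<in>{0..t}. gap_DC D U f g (x \<tau>)) \<le> \<epsilon>"
  proof (rule ccontr)
    assume *: "\<not> ?thesis"
    have "\<epsilon> / 2 \<le> \<phi> (x \<tau>) - \<phi> (x (Suc \<tau>))" if "\<tau> < Suc t" for \<tau>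
    proof -
      have "(MIN \<tau>\<in>{0..t}. gap_DC D U f g (x \<tau>)) \<le> gap_DC D U f g (x \<tau>)"
        using that by (intro Min_le) auto
      then show ?thesis
        using * step(3)[of \<tau>] by (simp add: \<phi>_def)
    qed
    then have "(\<Sum>\<tau><Suc t. \<epsilon> / 2) \<le> (\<Sum>\<tau><Suc t. \<phi> (x \<tau>) - \<phi> (x (Suc \<tau>)))"
      by (intro sum_mono) auto
    also have "\<dots> = \<phi> x0 - \<phi> (x (Suc t))"
      using sum_lessThan_telescope'[of "\<lambda>\<tau>. \<phi> (x \<tau>)" "Suc t"] by (simp only: x_0)
    also have "\<dots> \<le> \<Delta>"
      using inf_le[OF x_in] by (simp add: \<Delta>_def)
    finally show False
      using t(2) by (simp add: field_simps)
  qed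
  \<comment> \<open>The additive 4 per inner loop must be absorbed for large \<epsilon> as well. If
    t = 0 the sum is empty; otherwise 1 \<le> t \<le> 2 \<Delta> / \<epsilon>, so 4 \<le> 8 \<Delta>
    / \<epsilon>, the source of \<open>8 * \<Delta>\<close> in the constant.\<close>
  have calls_sum: "real (\<Sum>s<t. calls s) \<le> 2 * \<Delta> * (16 * (L * (diameter D)\<^sup>2) + 8 * \<Delta>) / \<epsilon>\<^sup>2"
  proof (cases "t = 0")
    case True
    then show ?thesis
      using \<Delta> L_nonneg by simp
  next
    case False
    then have "4 \<le> 4 * (2 * \<Delta> / \<epsilon>)"
      using t(1) by linarith
    also have "\<dots> = 8 * \<Delta> / \<epsilon>"
      by simp
    finally have "calls s \<le> (16 * (L * (diameter D)\<^sup>2) + 8 * \<Delta>) / \<epsilon>" for s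
      using step(2)[of s] by (simp add: calls_def add_divide_distrib)
    then have "real (\<Sum>s<t. calls s) \<le> real t * ((16 * (L * (diameter D)\<^sup>2) + 8 * \<Delta>) / \<epsilon>)"
      using sum_bounded_above[of "{..<t}" "\<lambda>s. real (calls s)"
        "(16 * (L * (diameter D)\<^sup>2) + 8 * \<Delta>) / \<epsilon>"]
      by simp
    also have "\<dots> \<le> 2 * \<Delta> / \<epsilon> * ((16 * (L * (diameter D)\<^sup>2) + 8 * \<Delta>) / \<epsilon>)"
      using t(1) \<Delta> L_nonneg by (intro mult_right_mono divide_nonneg_pos) auto
    finally show ?thesis
      by (simp add: power2_eq_square)
  qed
  show ?case
    unfolding Let_def
    using step(1) t(1) min_gap calls_sum unfolding calls_def \<Delta>_def \<phi>_def by blast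
qed

end
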